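(* Let $\mathcal{W}=(\mathcal{L},f)$ be a weighted lattice and let $H$ be a coatom of $\mathcal{L}$. Then \[ \mathbb{P}(\mathcal{W};z) = \mathbb{P}(\mathcal{W}|_H;z)\bigl(\mathbb{P}(\mathcal{W}/H;z)+1\bigr)- \sum_{b \text{ atom of } \mathcal{L},\ b \nleq H} \mathbb{P}(\mathcal{W}/b;z). \]
   Context: $\mathcal{L}$ is a finite modular complemented lattice with order $\le$, join $\vee$, meet $\wedge$, least element $\mathbf{0}$ and greatest element $\mathbf{1}$. An atom is an element covering $\mathbf{0}$; a coatom is an element covered by $\mathbf{1}$. $\mu$ denotes the Möbius function of $\mathcal{L}$. A weighted lattice is a pair $\mathcal{W}=(\mathcal{L},f)$ with $f:\mathcal{L}\to\mathbb{N}_0$, $f(\mathbf{0})=0$ and $f(A)\le f(B)$ whenever $A\le B$. For $X\le Y$ in $\mathcal{L}$, $\mathcal{W}([X,Y])$ is the weighted lattice on the interval $[X,Y]$ with weight $f_{[X,Y]}(T)=f(T)-f(X)$; write $\mathcal{W}|_Y=\mathcal{W}([\mathbf{0},Y])$ and $\mathcal{W}/X=\mathcal{W}([X,\mathbf{1}])$. The characteristic polynomial is $\mathbb{P}(\mathcal{W}([X,Y]);z)=\sum_{A\in[X,Y]}\mu(X,A)z^{f(Y)-f(A)}\in\mathbb{Z}[z]$; in particular $\mathbb{P}(\mathcal{W};z)=\sum_{A\in\mathcal{L}}\mu(\mathbf{0},A)z^{f(\mathbf{1})-f(A)}$. *)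

theory Defs
  imports "HOL-Computational_Algebra.Polynomial"
begin

text \<open>Complements need not be unique, so they are only required to exist; no complement
  operation is chosen (unlike the class \<open>complemented_lattice\<close> of HOL-Library).\<close>

class modular_complemented_lattice = bounded_lattice +
  assumes modular: "x \<le> z \<Longrightarrow> sup x (inf y z) = inf (sup x y) z"
    and complemented: "\<exists>y. inf x y = bot \<and> sup x y = top"

definition covered_by :: "'a::order \<Rightarrow> 'a \<Rightarrow> bool" where
  "covered_by x y \<longleftrightarrow> x < y \<and> \<not> (\<exists>z. x < z \<and> z < y)"

definition atom :: "'a::{order, order_bot} \<Rightarrow> bool" where
  "atom b \<longleftrightarrow> covered_by bot b"

definition coatom :: "'a::{order, order_top} \<Rightarrow> bool" where
  "coatom H \<longleftrightarrow> covered_by H top"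

text \<open>\<open>moebius x y\<close> only depends on the interval \<open>{x..y}\<close>, so it also is the Moebius function of
  every interval containing \<open>x\<close> and \<open>y\<close>.\<close>

function moebius :: "'a::{finite, order} \<Rightarrow> 'a \<Rightarrow> int" where
  "moebius x y =
     (if x = y then 1 else if x < y then - (\<Sum>z\<in>{x..<y}. moebius x z) else 0)"
  by auto
termination
proof (relation "measure (\<lambda>(x, y). card {x..y})")
  fix x y z :: 'a
  assume "\<not> x = y" "x < y" "z \<in> {x..<y}"
  then have "y \<in> {x..y}" "y \<notin> {x..z}" "{x..z} \<subseteq> {x..y}"
    by (auto simp: less_le_not_le intro: order_trans)
  then have "{x..z} \<subset> {x..y}"
    by blast
  then show "((x, z), (x, y)) \<in> measure (\<lambda>(x, y). card {x..y})"
    by (simp add: psubset_card_mono)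
qed simp

declare moebius.simps [simp del]

text \<open>A weighted lattice \<open>(L, f)\<close> is given by the type \<open>'a\<close> of elements of \<open>L\<close> together with \<open>f\<close>.\<close>

definition weight :: "('a::bounded_lattice \<Rightarrow> nat) \<Rightarrow> bool" where
  "weight f \<longleftrightarrow> f bot = 0 \<and> mono f"

text \<open>\<open>char_poly_on f X Y\<close> is the characteristic polynomial of the weighted lattice on \<open>{X..Y}\<close>
  whose weight is \<open>T \<mapsto> f T - f X\<close>; the summand \<open>f X\<close> cancels in the exponents. The subtraction in
  \<open>nat\<close> is a proper one, because \<open>A \<le> Y\<close> and weights are monotone.\<close>

definition char_poly_on ::
    "('a::{finite, bounded_lattice} \<Rightarrow> nat) \<Rightarrow> 'a \<Rightarrow> 'a \<Rightarrow> int poly" where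
  "char_poly_on f X Y = (\<Sum>A\<in>{X..Y}. monom (moebius X A) (f Y - f A))"

abbreviation char_poly :: "('a::{finite, bounded_lattice} \<Rightarrow> nat) \<Rightarrow> int poly" where
  "char_poly f \<equiv> char_poly_on f bot top"

abbreviation char_poly_restrict ::
    "('a::{finite, bounded_lattice} \<Rightarrow> nat) \<Rightarrow> 'a \<Rightarrow> int poly" where
  "char_poly_restrict f Y \<equiv> char_poly_on f bot Y"

abbreviation char_poly_contract ::
    "('a::{finite, bounded_lattice} \<Rightarrow> nat) \<Rightarrow> 'a \<Rightarrow> int poly" where
  "char_poly_contract f X \<equiv> char_poly_on f X top"

end

theory Submission
  imports Defs
begin

text \<open>The interval \<open>{H..top}\<close> has two elements, so \<open>char_poly_contract f H + 1\<close> is the monomial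
  that turns the first summand on the right into the part of \<open>char_poly f\<close> indexed by \<open>A \<le> H\<close>.
  For the other \<open>A\<close>, Weisner's theorem for \<open>{bot..A}\<close> and \<open>inf A H\<close> says that the values
  \<open>moebius x A\<close> at the \<open>x \<le> A\<close> with \<open>inf x H = bot\<close> sum to \<open>0\<close>. By modularity, these
  \<open>x\<close> are \<open>bot\<close> and the atoms below \<open>A\<close> that are not below \<open>H\<close>.\<close>

lemma moebius_refl [simp]: "moebius x x = 1"
  by (simp add: moebius.simps)

lemma sum_moebius_left:
  fixes x y :: "'a::{finite, order}"
  assumes "x \<le> y"
  shows "(\<Sum>z\<in>{x..y}. moebius x z) = (if x = y then 1 else 0)"
proof (cases "x = y")
  case False
  with assms have "x < y" by simp
  moreover have "{x..y} = insert y {x..<y}"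
    using assms by (auto simp: less_le)
  ultimately show ?thesis
    using False by (simp add: moebius.simps[of x y])
qed simp

text \<open>In the incidence algebra, the defining recursion says \<mu> * \<zeta> = \<delta>, and
  this is \<zeta> * \<mu> = \<delta>. The proof evaluates \<mu> = (\<mu> * \<zeta>) * \<mu> = \<mu>
  * (\<zeta> * \<mu>) at \<open>(x, y)\<close>.\<close>

lemma sum_moebius_right:
  fixes x y :: "'a::{finite, order}"
  assumes "x \<le> y"
  shows "(\<Sum>z\<in>{x..y}. moebius z y) = (if x = y then 1 else 0)"
  using assms
proof (induction "card {x..y}" arbitrary: x rule: less_induct)
  case less
  show ?case
  proof (cases "x = y")
    case False
    define g where "g z = (\<Sum>w\<in>{z..y}. moebius w y)" for z
    have g: "g z = (if z = y then 1 else 0)" if "x < z" "z \<le> y" for z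
    proof -
      have "{z..y} \<subset> {x..y}"
        using that less.prems by auto
      then show ?thesis
        unfolding g_def using less.hyps that by (simp add: psubset_card_mono)
    qed
    have "moebius x y = (\<Sum>w\<in>{x..y}. if w = x then moebius w y else 0)"
      using less.prems by simp
    also have "\<dots> = (\<Sum>w\<in>{x..y}. (\<Sum>z\<in>{x..w}. moebius x z) * moebius w y)"
      by (rule sum.cong) (auto simp: sum_moebius_left)
    also have "\<dots> = (\<Sum>w\<in>{x..y}. \<Sum>z | z \<in> {x..y} \<and> z \<le> w. moebius x z * moebius w y)"
      unfolding sum_distrib_right by (intro sum.cong) (auto intro: order_trans)
    also have "\<dots> = (\<Sum>z\<in>{x..y}. \<Sum>w | w \<in> {x..y} \<and> z \<le> w. moebius x z * moebius w y)"
      by (rule sum.swap_restrict) auto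
    also have "\<dots> = (\<Sum>z\<in>{x..y}. moebius x z * g z)"
      unfolding g_def sum_distrib_left by (intro sum.cong) (auto intro: order_trans)
    \<comment> \<open>The term at \<open>x\<close> is the sum sought. By induction only
      \<open>z = y\<close> survives among the others; it contributes \<open>moebius x y\<close>,
      which cancels the left-hand side and leaves \<open>g x = 0\<close>.\<close>
    also have "\<dots> = g x + (\<Sum>z\<in>{x..y} - {x}. moebius x z * g z)"
      using less.prems by (subst sum.remove[of _ x]) auto
    also have "(\<Sum>z\<in>{x..y} - {x}. moebius x z * g z)
        = (\<Sum>z\<in>{x..y} - {x}. if z = y then moebius x z else 0)"
      by (rule sum.cong) (auto simp: g less_le)
    also have "\<dots> = moebius x y"
      using less.prems False by simp
    finally show ?thesis
      using False by (simp add: g_def)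
  qed simp
qed

text \<open>The condition \<open>inf x a = bot\<close> is encoded as the sum of
  \<open>moebius bot z\<close> over \<open>z \<le> inf x a\<close>. After exchanging sums, each
  inner sum runs over \<open>{z..y}\<close> with \<open>z \<le> inf y a\<close>; here
  \<open>z \<noteq> y\<close> since \<open>y\<close> is not below \<open>a\<close>, so it
  vanishes.\<close>

lemma Weisner:
  fixes a y :: "'a::{finite, bounded_lattice}"
  assumes "\<not> y \<le> a"
  shows "(\<Sum>x | x \<le> y \<and> inf x a = bot. moebius x y) = 0"
proof -
  have "(\<Sum>x | x \<le> y \<and> inf x a = bot. moebius x y)
      = (\<Sum>x\<in>{..y}. if inf x a = bot then moebius x y else 0)"
    by (subst sum.inter_filter[symmetric]) auto
  also have "\<dots> = (\<Sum>x\<in>{..y}. (\<Sum>z\<in>{bot..inf x a}. moebius bot z) * moebius x y)"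
    by (rule sum.cong) (auto simp: sum_moebius_left)
  also have "\<dots> = (\<Sum>x\<in>{..y}. \<Sum>z | z \<in> {..inf y a} \<and> z \<le> x. moebius bot z * moebius x y)"
    unfolding sum_distrib_right by (intro sum.cong) (auto intro: order_trans)
  also have "\<dots> = (\<Sum>z\<in>{..inf y a}. \<Sum>x | x \<in> {..y} \<and> z \<le> x. moebius bot z * moebius x y)"
    by (rule sum.swap_restrict) auto
  also have "\<dots> = (\<Sum>z\<in>{..inf y a}. moebius bot z * (\<Sum>x\<in>{z..y}. moebius x y))"
    unfolding sum_distrib_left by (intro sum.cong) auto
  also have "\<dots> = 0"
    using assms by (intro sum.neutral) (auto simp: sum_moebius_right)
  finally show ?thesis .
qed

text \<open>By modularity, joining with \<open>H\<close> embeds \<open>{inf x H..x}\<close> into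
  \<open>{H..top}\<close>, which has only two elements.\<close>

lemma coatom_inf_covered_by:
  fixes H x :: "'a::modular_complemented_lattice"
  assumes "coatom H" and "\<not> x \<le> H"
  shows "covered_by (inf x H) x"
proof -
  have False if z: "inf x H < z" "z < x" for z
  proof -
    have "\<not> z \<le> H"
      using z by (metis inf.bounded_iff less_le_not_le)
    then have "H < sup z H"
      by (metis less_le sup.cobounded1 sup.cobounded2)
    with assms(1) have "sup z H = top"
      unfolding coatom_def covered_by_def using top.not_eq_extremum by blast
    \<comment> \<open>The left side is \<open>z\<close>, because \<open>inf H x \<le> z\<close>; the
      right side is \<open>x\<close>, because \<open>sup z H = top\<close>.\<close>
    moreover have "sup z (inf H x) = inf (sup z H) x"
      using z by (intro modular) simp
    moreover have "sup z (inf H x) = z"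
      using z by (simp add: inf.commute sup_absorb1)
    ultimately show False
      using z by simp
  qed
  moreover have "inf x H < x"
    using assms(2) by (metis inf.cobounded1 inf.absorb_iff1 less_le)
  ultimately show ?thesis
    by (auto simp: covered_by_def)
qed

lemma coatom_inf_eq_bot_iff:
  fixes H x :: "'a::modular_complemented_lattice"
  assumes "coatom H"
  shows "inf x H = bot \<longleftrightarrow> x = bot \<or> atom x \<and> \<not> x \<le> H"
proof
  assume *: "inf x H = bot"
  show "x = bot \<or> atom x \<and> \<not> x \<le> H"
  proof (cases "x \<le> H")
    case True
    with * show ?thesis by (simp add: inf_absorb1)
  next
    case False
    with coatom_inf_covered_by[OF assms False] * show ?thesis
      by (simp add: atom_def)
  qed
next
  assume "x = bot \<or> atom x \<and> \<not> x \<le> H"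
  then show "inf x H = bot"
  proof
    assume x: "atom x \<and> \<not> x \<le> H"
    then have "inf x H < x"
      by (metis inf.cobounded1 inf.absorb_iff1 less_le)
    with x show ?thesis
      unfolding atom_def covered_by_def using bot.not_eq_extremum by blast
  qed simp
qed

lemma moebius_bot_eq_sum_atoms:
  fixes A H :: "'a::{finite, modular_complemented_lattice}"
  assumes "coatom H" and "\<not> A \<le> H"
  shows "moebius bot A = - (\<Sum>b | atom b \<and> \<not> b \<le> H \<and> b \<le> A. moebius b A)"
proof -
  have "{x. x \<le> A \<and> inf x H = bot} = insert bot {b. atom b \<and> \<not> b \<le> H \<and> b \<le> A}"
    using coatom_inf_eq_bot_iff[OF assms(1)] by auto
  \<comment> \<open>Since \<open>bot \<le> H\<close>, the inserted \<open>bot\<close> is not among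
    the atoms, and its term splits off from Weisner's sum.\<close>
  then show ?thesis
    using Weisner[OF assms(2)] by simp
qed

text \<open>As \<open>moebius H top = - 1\<close>, the term at \<open>top\<close> is the constant
  -1, which the added 1 cancels.\<close>

lemma char_poly_contract_coatom:
  fixes f :: "'a::{finite, bounded_lattice} \<Rightarrow> nat"
  assumes "coatom H"
  shows "char_poly_contract f H + 1 = monom 1 (f top - f H)"
proof -
  have H: "H \<noteq> top" "{H..top} = {H, top}" "{H..<top} = {H}" "H < top"
    using assms by (auto simp: coatom_def covered_by_def less_le)
  then show ?thesis
    by (simp add: char_poly_on_def moebius.simps[of H top] flip: minus_monom monom_eq_1)
qed

lemma char_poly_restrict_mult_monom:
  assumes "mono f"
  shows "char_poly_restrict f H * monom 1 (f top - f H)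
    = (\<Sum>A\<in>{..H}. monom (moebius bot A) (f top - f A))"
  unfolding char_poly_on_def sum_distrib_right
proof (rule sum.cong)
  fix A assume "A \<in> {..H}"
  \<comment> \<open>These bounds make the truncated subtractions exact, so the exponents add up to
    \<open>f top - f A\<close>.\<close>
  then have "f A \<le> f H" "f H \<le> f top"
    using assms by (auto intro: monoD)
  then show "monom (moebius bot A) (f H - f A) * monom 1 (f top - f H)
      = monom (moebius bot A) (f top - f A)"
    by (simp add: mult_monom)
qed auto

theorem theorem3p2:
  fixes f :: "'a::{finite, modular_complemented_lattice} \<Rightarrow> nat" and H :: 'a
  assumes "weight f" and "coatom H"
  shows "char_poly f =
    char_poly_restrict f H * (char_poly_contract f H + 1)
      - (\<Sum>b\<in>{b. atom b \<and> \<not> b \<le> H}. char_poly_contract f b)"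
proof -
  let ?B = "{b. atom b \<and> \<not> b \<le> H}"
  let ?m = "\<lambda>x A. monom (moebius x A) (f top - f A)"
  \<comment> \<open>No \<open>A\<close> above some \<open>b\<close> in \<open>?B\<close> lies below
    \<open>H\<close>, so restricting to the complement of \<open>{..H}\<close> loses no
    term.\<close>
  have "(\<Sum>b\<in>?B. char_poly_contract f b) = (\<Sum>b\<in>?B. \<Sum>A | A \<in> - {..H} \<and> b \<le> A. ?m b A)"
    unfolding char_poly_on_def by (intro sum.cong) (auto intro: order_trans)
  also have "\<dots> = (\<Sum>A\<in>- {..H}. \<Sum>b | b \<in> ?B \<and> b \<le> A. ?m b A)"
    by (rule sum.swap_restrict) auto
  \<comment> \<open>The exponent does not depend on \<open>b\<close>, so the inner sum collapses to
    a single monomial whose coefficient is the sum over atoms.\<close>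
  also have "\<dots> = (\<Sum>A\<in>- {..H}. - ?m bot A)"
    by (rule sum.cong)
      (simp_all add: moebius_bot_eq_sum_atoms[OF assms(2)] monom_sum conj_assoc flip: minus_monom)
  finally have B: "(\<Sum>b\<in>?B. char_poly_contract f b) = - (\<Sum>A\<in>- {..H}. ?m bot A)"
    by (simp add: sum_negf)
  have "char_poly f = (\<Sum>A\<in>{..H} \<union> - {..H}. ?m bot A)"
    unfolding char_poly_on_def by (rule sum.cong) auto
  also have "\<dots> = (\<Sum>A\<in>{..H}. ?m bot A) + (\<Sum>A\<in>- {..H}. ?m bot A)"
    by (rule sum.union_disjoint) auto
  finally show ?thesis
    using assms(1) unfolding char_poly_contract_coatom[OF assms(2)] B
    by (simp add: weight_def char_poly_restrict_mult_monom)
qed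

end
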